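(* Let $\boldsymbol{s}=(s_1,s_2,\ldots,s_n)\in\mathbb{Z}_{\ge1}^n$ and let $r=\max\{\operatorname{asc}(\boldsymbol{e}) : \boldsymbol{e}\in\mathbf{I}_n^{(\boldsymbol{s})}\}$. Then the $\boldsymbol{s}$-lecture hall polytope $\mathbf{P}_n^{(\boldsymbol{s})}$ is level if and only if for any $\boldsymbol{e}\in\mathbf{I}_{n,k}^{(\boldsymbol{s})}$ with $1\leq k<r$ there exists some $\boldsymbol{e}'\in\mathbf{I}_{n,1}^{(\boldsymbol{s})}$ such that $\boldsymbol{e}+\boldsymbol{e}'\in\mathbf{I}_{n,k+1}^{(\boldsymbol{s})}$.
   Context: For $\boldsymbol{s}=(s_1,\ldots,s_n)\in\mathbb{Z}_{\ge1}^n$, the $\boldsymbol{s}$-lecture hall polytope is $$\mathbf{P}_n^{(\boldsymbol{s})}=\left\{\boldsymbol{\lambda}\in\mathbb{R}^n : 0\leq\frac{\lambda_1}{s_1}\leq\cdots\leq\frac{\lambda_n}{s_n}\leq 1\right\},$$ a lattice simplex. Inversion sequences: $\mathbf{I}_n^{(\boldsymbol{s})}=\{\boldsymbol{e}\in\mathbb{Z}_{\ge0}^n : 0\leq e_i<s_i\}$. With conventions $s_0=1$, $e_0=0$, the ascent set of $\boldsymbol{e}$ is $\operatorname{Asc}(\boldsymbol{e})=\{i\in\{0,1,\ldots,n-1\} : \frac{e_i}{s_i}<\frac{e_{i+1}}{s_{i+1}}\}$, $\operatorname{asc}(\boldsymbol{e})=\#\operatorname{Asc}(\boldsymbol{e})$,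 and $\mathbf{I}_{n,k}^{(\boldsymbol{s})}=\{\boldsymbol{e}\in\mathbf{I}_n^{(\boldsymbol{s})} : \operatorname{asc}(\boldsymbol{e})=k\}$. For $\boldsymbol{e},\boldsymbol{e}'\in\mathbf{I}_n^{(\boldsymbol{s})}$, $\boldsymbol{e}+\boldsymbol{e}'$ denotes the inversion sequence whose $i$th entry is $(e_i+e_i')\bmod s_i\in\{0,\ldots,s_i-1\}$. Levelness: for a lattice polytope $P\subset\mathbb{R}^n$ with vertex set $V(P)$, $\mathrm{cone}(P)=\mathrm{span}_{\mathbb{R}_{\ge0}}\{(\boldsymbol{v},1):\boldsymbol{v}\in V(P)\}\subset\mathbb{R}^{n+1}$, with relative interior $\mathrm{cone}(P)^\circ$. $P$ is level if the semigroup algebra $k[P]=k[\mathrm{cone}(P)\cap\mathbb{Z}^{n+1}]$ ($k$ an algebraically closed field of characteristic zero, graded by the last coordinate) is level, i.e. its canonical module $k[\mathrm{cone}(P)^\circ\cap\mathbb{Z}^{n+1}]$ is generated by elements of the same degree; equivalently, there are finitely many $\boldsymbol{c}_1,\ldots,\boldsymbol{c}_m\in\mathbb{Z}^{n+1}$, all with the same last coordinate, such that $\bigcup_{i=1}^m\bigl(\boldsymbol{c}_i+(\mathrm{cone}(P)\cap\mathbb{Z}^{n+1})\bigr)=\mathrm{cone}(P)^\circ\cap\mathbb{Z}^{n+1}$. *)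

theory Defs
  imports
    "HOL-Analysis.Analysis"
    "HOL-Library.Poly_Mapping"
    "HOL-Computational_Algebra.Polynomial"
begin

text \<open>
  The dimension \<open>n\<close> is \<open>CARD('n)\<close> for a finite linearly ordered index type \<open>'n\<close>;
  the \<open>i\<close>-th coordinate, \<open>1 \<le> i \<le> CARD('n)\<close>, is the one at the \<open>i\<close>-th smallest index.
\<close>

definition nth_index :: "nat \<Rightarrow> 'n::{finite,linorder}" where
  "nth_index i = sorted_list_of_set (UNIV :: 'n set) ! (i - 1)"

definition coord :: "'a ^ 'n::{finite,linorder} \<Rightarrow> nat \<Rightarrow> 'a" where
  "coord x i = x $ nth_index i"

definition lecture_hall_polytope :: "nat ^ 'n::{finite,linorder} \<Rightarrow> (real ^ 'n::{finite,linorder}) set" where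
  "lecture_hall_polytope s =
     {x. 0 \<le> coord x 1 / real (coord s 1) \<and>
         (\<forall>i\<in>{1..<CARD('n)}.
            coord x i / real (coord s i) \<le> coord x (i + 1) / real (coord s (i + 1))) \<and>
         coord x CARD('n) / real (coord s CARD('n)) \<le> 1}"

definition inversion_sequences :: "nat ^ 'n \<Rightarrow> (nat ^ 'n) set" where
  "inversion_sequences s = {e. \<forall>j. e $ j < s $ j}"

text \<open>The \<open>i\<close>-th ratio \<open>e\<^sub>i / s\<^sub>i\<close>, where \<open>e\<^sub>0 = 0\<close> and \<open>s\<^sub>0 = 1\<close>.\<close>

definition inv_ratio :: "nat ^ 'n::{finite,linorder} \<Rightarrow> nat ^ 'n::{finite,linorder} \<Rightarrow> nat \<Rightarrow> real" where
  "inv_ratio s e i =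
     real (if i = 0 then 0 else coord e i) / real (if i = 0 then 1 else coord s i)"

definition Asc :: "nat ^ 'n::{finite,linorder} \<Rightarrow> nat ^ 'n::{finite,linorder} \<Rightarrow> nat set" where
  "Asc s e = {i \<in> {0..<CARD('n)}. inv_ratio s e i < inv_ratio s e (i + 1)}"

definition asc :: "nat ^ 'n::{finite,linorder} \<Rightarrow> nat ^ 'n::{finite,linorder} \<Rightarrow> nat" where
  "asc s e = card (Asc s e)"

definition inversion_sequences_asc ::
    "nat ^ 'n::{finite,linorder} \<Rightarrow> nat \<Rightarrow> (nat ^ 'n::{finite,linorder}) set" where
  "inversion_sequences_asc s k = {e \<in> inversion_sequences s. asc s e = k}"

definition inv_add :: "nat ^ 'n \<Rightarrow> nat ^ 'n \<Rightarrow> nat ^ 'n \<Rightarrow> nat ^ 'n" where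
  "inv_add s e e' = (\<chi> j. (e $ j + e' $ j) mod s $ j)"

definition polytope_cone :: "(real ^ 'n) set \<Rightarrow> ((real ^ 'n) \<times> real) set" where
  "polytope_cone P = convex_cone hull ((\<lambda>v. (v, 1)) ` {v. v extreme_point_of P})"

definition lattice_points :: "((real ^ 'n) \<times> real) set \<Rightarrow> ((int ^ 'n) \<times> int) set" where
  "lattice_points C = {(m, d). ((\<chi> j. real_of_int (m $ j)), real_of_int d) \<in> C}"

text \<open>
  The Laurent polynomial ring over \<open>'k\<close> in \<open>CARD('n) + 1\<close> variables is the type
  \<open>((int ^ 'n) \<times> int) \<Rightarrow>\<^sub>0 'k\<close> with convolution as multiplication. Inside it,
  \<open>monomial_span S\<close> is the \<open>'k\<close>-linear span of the monomials with exponent in \<open>S\<close>.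
\<close>

definition monomial_span :: "'m set \<Rightarrow> ('m \<Rightarrow>\<^sub>0 'k::zero) set" where
  "monomial_span S = {f. Poly_Mapping.keys f \<subseteq> S}"

definition semigroup_algebra :: "(real ^ 'n) set \<Rightarrow> (((int ^ 'n) \<times> int) \<Rightarrow>\<^sub>0 'k::field) set" where
  "semigroup_algebra P = monomial_span (lattice_points (polytope_cone P))"

definition canonical_module :: "(real ^ 'n) set \<Rightarrow> (((int ^ 'n) \<times> int) \<Rightarrow>\<^sub>0 'k::field) set" where
  "canonical_module P = monomial_span (lattice_points (rel_interior (polytope_cone P)))"

definition homogeneous_of_degree :: "int \<Rightarrow> (((int ^ 'n) \<times> int) \<Rightarrow>\<^sub>0 'k::zero) \<Rightarrow> bool" where
  "homogeneous_of_degree d f \<longleftrightarrow> (\<forall>m\<in>Poly_Mapping.keys f. snd m = d)"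

text \<open>The \<open>A\<close>-submodule generated by \<open>G\<close>, for a subring \<open>A\<close> of the ambient ring.\<close>

definition submodule_generated :: "'r::comm_ring_1 set \<Rightarrow> 'r set \<Rightarrow> 'r set" where
  "submodule_generated A G =
     {(\<Sum>g\<in>F. a g * g) | F a. finite F \<and> F \<subseteq> G \<and> (\<forall>g\<in>F. a g \<in> A)}"

definition level_polytope ::
    "'k::{alg_closed_field, field_char_0} itself \<Rightarrow> (real ^ 'n) set \<Rightarrow> bool" where
  "level_polytope K P \<longleftrightarrow>
     (\<exists>d (G :: (((int ^ 'n) \<times> int) \<Rightarrow>\<^sub>0 'k) set).
        (\<forall>g\<in>G. homogeneous_of_degree d g) \<and>
        submodule_generated (semigroup_algebra P) G = canonical_module P)"

end

theory Submission
  imports Defs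
begin

text \<open>
  The cone over the polytope is simplicial, so every lattice point is determined by its class
  modulo the lattice spanned by the \<open>(v, 1)\<close>, \<open>v\<close> a vertex, and by the integral parts of its
  coefficients. The points \<open>b(e)\<close> of the half-open parallelepiped are indexed by inversion
  sequences, the height of \<open>b(e)\<close> is \<open>asc(e)\<close>, and the interior points are the \<open>V - b(e)\<close> plus
  combinations of the \<open>(v, 1)\<close>, where \<open>V\<close> is the sum of all \<open>(v, 1)\<close>. Hence the canonical module is
  generated in one degree, necessarily the lowest degree \<open>n + 1 - r\<close>, iff every \<open>b(e)\<close> lies
  below some \<open>b(f)\<close> with \<open>asc(f) = r\<close> in the order given by the cone. Given the condition on
  inversion sequences, one climbs from \<open>e\<close> to such an \<open>f\<close> by adding sequences with one ascent, because
  \<open>asc(e + e') = asc(e) + asc(e')\<close> forces \<open>b(e + e') = b(e) + b(e')\<close>. Conversely \<open>b(f) - b(e)\<close> has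
  a summand of height one, by the integer decomposition property, and this summand is
  the required \<open>b(e')\<close>.
\<close>

subsection \<open>The cone over the lecture hall polytope\<close>

lemma bij_betw_nth_index:
  "bij_betw nth_index {1..CARD('n)} (UNIV :: 'n::{finite,linorder} set)"
proof -
  have "bij_betw (\<lambda>i. i - 1) {1..CARD('n)} {..<CARD('n)}"
    by (rule bij_betw_byWitness[where f' = Suc]) auto
  moreover have "bij_betw ((!) (sorted_list_of_set (UNIV :: 'n set))) {..<CARD('n)} UNIV"
    by (rule bij_betw_nth) auto
  ultimately show ?thesis
    unfolding nth_index_def using bij_betw_trans by (fastforce simp: comp_def)
qed

lemma all_index_iff:
  "(\<forall>j :: 'n::{finite,linorder}. Q j) \<longleftrightarrow> (\<forall>i\<in>{1..CARD('n)}. Q (nth_index i))"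
  using bij_betw_imp_surj_on[OF bij_betw_nth_index[where 'n = 'n]] by (metis UNIV_I imageE)

lemma vec_eq_coord_iff:
  "x = y \<longleftrightarrow> (\<forall>i\<in>{1..CARD('n)}. coord x i = coord y i)" for x y :: "'a ^ 'n::{finite,linorder}"
  by (simp add: vec_eq_iff all_index_iff coord_def)

definition vec_of_coords :: "(nat \<Rightarrow> 'a) \<Rightarrow> 'a ^ 'n::{finite,linorder}" where
  "vec_of_coords f = (\<chi> j. f (inv_into {1..CARD('n)} nth_index j))"

lemma coord_vec_of_coords [simp]:
  "i \<in> {1..CARD('n)} \<Longrightarrow> coord (vec_of_coords f :: 'a ^ 'n::{finite,linorder}) i = f i"
  unfolding coord_def vec_of_coords_def
  using bij_betw_inv_into_left[OF bij_betw_nth_index[where 'n = 'n], of i] by simp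

text \<open>
  The ratios \<open>\<lambda>\<^sub>i / s\<^sub>i\<close> of a point \<open>(\<lambda>, t)\<close>, extended by \<open>0\<close> at index \<open>0\<close> and by the height \<open>t\<close>
  at index \<open>n + 1\<close>. The cone is simplicial, and the differences of consecutive ratios are
  the coefficients of the point with respect to the vertices.
\<close>

definition cone_ratio :: "nat ^ 'n::{finite,linorder} \<Rightarrow> (real ^ 'n::{finite,linorder}) \<times> real \<Rightarrow> nat \<Rightarrow> real" where
  "cone_ratio s p i =
     (if i = 0 then 0
      else if i \<le> CARD('n) then coord (fst p) i / real (coord s i) else snd p)"

definition facet :: "nat ^ 'n::{finite,linorder} \<Rightarrow> (real ^ 'n::{finite,linorder}) \<times> real \<Rightarrow> nat \<Rightarrow> real" where
  "facet s p i = cone_ratio s p (Suc i) - cone_ratio s p i"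

text \<open>Facet description of the cone; \<open>polytope_cone_lecture_hall\<close> identifies it
  with the cone spanned by the vertices.\<close>

definition lh_cone :: "nat ^ 'n::{finite,linorder} \<Rightarrow> ((real ^ 'n::{finite,linorder}) \<times> real) set" where
  "lh_cone s = {p. \<forall>i\<le>CARD('n). 0 \<le> facet s p i}"

definition lh_cone_interior :: "nat ^ 'n::{finite,linorder} \<Rightarrow> ((real ^ 'n::{finite,linorder}) \<times> real) set" where
  "lh_cone_interior s = {p. \<forall>i\<le>CARD('n). 0 < facet s p i}"

lemma facet_add: "facet s (p + q) i = facet s p i + facet s q i"
  by (simp add: facet_def cone_ratio_def coord_def add_divide_distrib)

lemma facet_diff: "facet s (p - q) i = facet s p i - facet s q i"
  by (simp add: facet_def cone_ratio_def coord_def diff_divide_distrib)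

lemma facet_scaleR: "facet s (c *\<^sub>R p) i = c * facet s p i"
  by (simp add: facet_def cone_ratio_def coord_def algebra_simps)

lemma cone_ratio_eq_sum: "cone_ratio s p i = (\<Sum>j<i. facet s p j)"
  unfolding facet_def by (subst sum_lessThan_telescope) (simp add: cone_ratio_def)

text \<open>All generators have height 1, so the height is the sum of the coefficients.\<close>

lemma snd_eq_sum_facet:
  "snd p = (\<Sum>j\<le>CARD('n). facet s p j)" for s :: "nat ^ 'n::{finite,linorder}"
  using cone_ratio_eq_sum[of s p "Suc CARD('n)"] by (simp add: cone_ratio_def lessThan_Suc_atMost)

lemma continuous_on_facet [continuous_intros]: "continuous_on A (\<lambda>p. facet s p i)"
proof -
  have "linear (\<lambda>p. facet s p i)"
    by (rule linearI) (simp_all add: facet_add facet_scaleR)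
  then show ?thesis by (simp add: linear_continuous_on linear_conv_bounded_linear)
qed

lemma coord_pos: "\<forall>j. 1 \<le> s $ j \<Longrightarrow> 0 < coord s i" for s :: "nat ^ 'n::{finite,linorder}"
  unfolding coord_def by (metis less_le_trans zero_less_one)

lemma eq_0_if_facet_eq_0:
  fixes s :: "nat ^ 'n::{finite,linorder}"
  assumes "\<forall>j. 1 \<le> s $ j" "\<And>i. i \<le> CARD('n) \<Longrightarrow> facet s p i = 0"
  shows "p = 0"
proof -
  have r: "cone_ratio s p i = 0" if "i \<le> Suc CARD('n)" for i
    using that by (auto simp: cone_ratio_eq_sum intro!: sum.neutral assms(2))
  have "coord (fst p) i = 0" if "i \<in> {1..CARD('n)}" for i
    using r[of i] that coord_pos[OF assms(1), of i] by (simp add: cone_ratio_def)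
  then have "fst p = 0"
    by (simp add: vec_eq_coord_iff) (simp add: coord_def)
  moreover have "snd p = 0"
    using r[of "Suc CARD('n)"] by (simp add: cone_ratio_def)
  ultimately show ?thesis by (simp add: prod_eq_iff)
qed

lemma convex_cone_lh_cone: "convex_cone (lh_cone s)"
  unfolding convex_cone_iff
  by (auto simp: lh_cone_def facet_add facet_scaleR) (simp add: facet_def cone_ratio_def coord_def)

lemma closed_lh_cone: "closed (lh_cone s)"
proof -
  have "lh_cone s = (\<Inter>i\<le>CARD('a). {p. 0 \<le> facet s p i})"
    by (auto simp: lh_cone_def)
  then show ?thesis
    by (auto intro!: closed_INT closed_Collect_le continuous_intros)
qed

lemma mem_lecture_hall_polytope_iff:
  "x \<in> lecture_hall_polytope s \<longleftrightarrow> (x, 1) \<in> lh_cone s"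
proof -
  let ?n = "CARD('a)"
  have n: "?n \<ge> 1" by (simp add: Suc_leI)
  \<comment> \<open>Splits off the first and the last facet, which the definition of the polytope
    states separately.\<close>
  have *: "(\<forall>i\<le>?n. Q i) \<longleftrightarrow> Q 0 \<and> (\<forall>i\<in>{1..<?n}. Q i) \<and> Q ?n" for Q
    by (auto simp: le_less) (metis One_nat_def Suc_leI atLeastLessThan_iff neq0_conv)
  show ?thesis
    using n unfolding lh_cone_def mem_Collect_eq * lecture_hall_polytope_def
    by (simp add: facet_def cone_ratio_def)
qed

lemma cone_ratio_bounds:
  fixes s :: "nat ^ 'n::{finite,linorder}"
  assumes "p \<in> lh_cone s" "i \<le> Suc CARD('n)"
  shows "0 \<le> cone_ratio s p i" "cone_ratio s p i \<le> snd p"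
proof -
  have f: "facet s p j \<ge> 0" if "j \<le> CARD('n)" for j
    using assms(1) that by (auto simp: lh_cone_def)
  show "0 \<le> cone_ratio s p i"
    using assms(2) by (auto simp: cone_ratio_eq_sum intro!: sum_nonneg f)
  have "(\<Sum>j<i. facet s p j) \<le> (\<Sum>j<Suc CARD('n). facet s p j)"
    using assms(2) by (intro sum_mono2) (auto intro: f)
  then show "cone_ratio s p i \<le> snd p"
    using snd_eq_sum_facet[of p s] by (simp add: cone_ratio_eq_sum lessThan_Suc_atMost)
qed

section \<open>Identification with the cone over the polytope\<close>

lemma compact_lecture_hall_polytope:
  fixes s :: "nat ^ 'n::{finite,linorder}"
  assumes "\<forall>j. 1 \<le> s $ j"
  shows "compact (lecture_hall_polytope s)"
proof -
  have eq: "lecture_hall_polytope s = (\<lambda>x. (x, 1)) -` lh_cone s"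
    by (auto simp: mem_lecture_hall_polytope_iff)
  have "closed (lecture_hall_polytope s)"
    unfolding eq by (intro continuous_closed_vimage closed_lh_cone continuous_intros)
  moreover have "bounded (lecture_hall_polytope s)"
  proof (rule bounded_subset)
    show "lecture_hall_polytope s \<subseteq> cbox 0 (\<chi> j. real (s $ j))"
    proof
      fix x assume "x \<in> lecture_hall_polytope s"
      then have x: "(x, 1) \<in> lh_cone s" by (simp add: mem_lecture_hall_polytope_iff)
      have "\<forall>j. 0 \<le> x $ j \<and> x $ j \<le> real (s $ j)"
        unfolding all_index_iff
      proof
        fix i assume i: "i \<in> {1..CARD('n)}"
        have "1 \<le> s $ nth_index i" using assms by blast
        moreover have "0 \<le> x $ nth_index i / s $ nth_index i" "x $ nth_index i / s $ nth_index i \<le> 1"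
          using cone_ratio_bounds[OF x, of i] i by (auto simp: cone_ratio_def coord_def)
        ultimately show "0 \<le> x $ nth_index i \<and> x $ nth_index i \<le> real (s $ nth_index i)"
          by (auto simp: field_simps)
      qed
      then show "x \<in> cbox 0 (\<chi> j. real (s $ j))"
        by (simp add: mem_box_cart)
    qed
  qed simp
  ultimately show ?thesis by (simp add: compact_eq_bounded_closed)
qed

lemma convex_lecture_hall_polytope: "convex (lecture_hall_polytope s)"
proof (rule convexI)
  fix x y and u v :: real
  assume *: "x \<in> lecture_hall_polytope s" "y \<in> lecture_hall_polytope s" "0 \<le> u" "0 \<le> v" "u + v = 1"
  moreover have "convex (lh_cone s)"
    using convex_cone_lh_cone[of s] by (simp add: convex_cone_def)
  ultimately have "u *\<^sub>R (x, 1) + v *\<^sub>R (y, 1) \<in> lh_cone s"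
    by (intro convexD) (simp_all add: mem_lecture_hall_polytope_iff)
  then show "u *\<^sub>R x + v *\<^sub>R y \<in> lecture_hall_polytope s"
    using * by (simp add: mem_lecture_hall_polytope_iff)
qed

text \<open>The polytope is compact and convex, hence by Krein-Milman the hull of its extreme
  points. This covers the cone points of height 1, and scaling covers those of positive
  height.\<close>

lemma polytope_cone_lecture_hall:
  fixes s :: "nat ^ 'n::{finite,linorder}"
  assumes "\<forall>j. 1 \<le> s $ j"
  shows "polytope_cone (lecture_hall_polytope s) = lh_cone s"
proof
  let ?P = "lecture_hall_polytope s"
  let ?V = "{v. v extreme_point_of ?P}"
  let ?H = "convex_cone hull ((\<lambda>v. (v, 1 :: real)) ` ?V)"
  show "polytope_cone ?P \<subseteq> lh_cone s"
    unfolding polytope_cone_def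
  proof (rule hull_minimal)
    show "(\<lambda>v. (v, 1)) ` ?V \<subseteq> lh_cone s"
      by (auto simp: extreme_point_of_def mem_lecture_hall_polytope_iff)
  qed (rule convex_cone_lh_cone)
  have lift: "(x, 1) \<in> ?H" if "x \<in> ?P" for x
  proof -
    have "?P = convex hull ?V"
      by (intro Krein_Milman_Minkowski compact_lecture_hall_polytope convex_lecture_hall_polytope assms)
    also have "convex hull ?V \<subseteq> {x. (x, 1) \<in> ?H}"
    proof (rule hull_minimal)
      show "?V \<subseteq> {x. (x, 1) \<in> ?H}" by (auto intro: hull_inc)
      show "convex {x. (x, 1) \<in> ?H}"
      proof (rule convexI, clarify)
        fix x y and u v :: real
        assume *: "(x, 1) \<in> ?H" "(y, 1) \<in> ?H" "0 \<le> u" "0 \<le> v" "u + v = 1"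
        then have "u *\<^sub>R (x, 1) + v *\<^sub>R (y, 1) \<in> ?H"
          by (intro convex_cone_hull_add convex_cone_hull_mul)
        then show "(u *\<^sub>R x + v *\<^sub>R y, 1) \<in> ?H" using * by simp
      qed
    qed
    finally show ?thesis using that by auto
  qed
  show "lh_cone s \<subseteq> polytope_cone ?P"
  proof
    fix p assume p: "p \<in> lh_cone s"
    obtain x t where xt: "p = (x, t)" by fastforce
    have f: "facet s p i \<ge> 0" if "i \<le> CARD('n)" for i
      using p that by (auto simp: lh_cone_def)
    have t0: "t \<ge> 0"
      using cone_ratio_bounds[OF p, of 0] by (simp add: xt)
    show "p \<in> polytope_cone ?P"
    \<comment> \<open>Scaling to height 1 fails at height 0, but there all facet values vanish and
      the point is the apex.\<close>
    proof (cases "t = 0")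
      case True
      then have "(\<Sum>j\<le>CARD('n). facet s p j) = 0"
        using snd_eq_sum_facet[of p s] by (simp add: xt)
      then have "\<forall>i\<in>{..CARD('n)}. facet s p i = 0"
        by (subst (asm) sum_nonneg_eq_0_iff) (auto intro: f)
      then have "p = 0" using eq_0_if_facet_eq_0[OF assms, of p] by auto
      then show ?thesis by (simp add: polytope_cone_def convex_cone_hull_contains_0)
    next
      case False
      then have "(1 / t) *\<^sub>R p \<in> lh_cone s"
        using convex_cone_lh_cone[of s] p t0 by (simp add: convex_cone_iff)
      then have "((1 / t) *\<^sub>R x, 1) \<in> ?H"
        using False by (intro lift) (simp add: xt mem_lecture_hall_polytope_iff)
      then have "t *\<^sub>R ((1 / t) *\<^sub>R x, 1) \<in> ?H"
        using t0 by (rule convex_cone_hull_mul)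
      then show ?thesis using False by (simp add: xt polytope_cone_def)
    qed
  qed
qed

text \<open>The sum of all \<open>(v, 1)\<close> with \<open>v\<close> a vertex, i.e. the point with all \<open>facet\<close> values \<open>1\<close>.\<close>

definition vertex_sum :: "nat ^ 'n::{finite,linorder} \<Rightarrow> (int ^ 'n::{finite,linorder}) \<times> int" where
  "vertex_sum s = (vec_of_coords (\<lambda>i. int (i * coord s i)), int CARD('n) + 1)"

definition of_lattice :: "(int ^ 'n::{finite,linorder}) \<times> int \<Rightarrow> (real ^ 'n::{finite,linorder}) \<times> real" where
  "of_lattice p = ((\<chi> j. real_of_int (fst p $ j)), real_of_int (snd p))"

lemma of_lattice_add: "of_lattice (p + q) = of_lattice p + of_lattice q"
  by (simp add: of_lattice_def vec_eq_iff)

lemma of_lattice_diff: "of_lattice (p - q) = of_lattice p - of_lattice q"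
  by (simp add: of_lattice_def vec_eq_iff)

text \<open>The ratio at each index \<open>i\<close> up to n + 1 is \<open>i\<close> itself.\<close>

lemma facet_vertex_sum:
  fixes s :: "nat ^ 'n::{finite,linorder}"
  assumes "\<forall>j. 1 \<le> s $ j" "i \<le> CARD('n)"
  shows "facet s (of_lattice (vertex_sum s)) i = 1"
proof -
  have "cone_ratio s (of_lattice (vertex_sum s)) i = real i" if "i \<le> Suc CARD('n)" for i
  proof (cases "i \<in> {1..CARD('n)}")
    case True
    have "coord s i \<noteq> 0" using coord_pos[OF assms(1)] by simp
    moreover have "coord (fst (of_lattice (vertex_sum s))) i = real (i * coord s i)"
      using coord_vec_of_coords[OF True, of "\<lambda>i. int (i * coord s i)"]
      by (simp add: of_lattice_def vertex_sum_def coord_def)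
    ultimately show ?thesis using True by (simp add: cone_ratio_def)
  next
    case False
    then have "i = 0 \<or> i = Suc CARD('n)" using that by auto
    then show ?thesis by (auto simp: cone_ratio_def of_lattice_def vertex_sum_def)
  qed
  then show ?thesis using assms(2) by (simp add: facet_def)
qed

text \<open>\<open>vertex_sum s\<close> satisfies all facet inequalities strictly, so the cone is
  full-dimensional and its relative interior is its interior.\<close>

lemma rel_interior_lh_cone:
  fixes s :: "nat ^ 'n::{finite,linorder}"
  assumes "\<forall>j. 1 \<le> s $ j"
  shows "rel_interior (lh_cone s) = lh_cone_interior s"
proof -
  let ?v = "of_lattice (vertex_sum s)"
  have "lh_cone_interior s = (\<Inter>i\<le>CARD('n). {p. 0 < facet s p i})"
    by (auto simp: lh_cone_interior_def)
  then have "open (lh_cone_interior s)"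
    by (auto intro!: open_INT open_Collect_less continuous_intros)
  then have sub: "lh_cone_interior s \<subseteq> interior (lh_cone s)"
    by (rule interior_maximal[rotated]) (auto simp: lh_cone_def lh_cone_interior_def less_imp_le)
  have "?v \<in> lh_cone_interior s"
    using facet_vertex_sum[OF assms] by (simp add: lh_cone_interior_def)
  then have "rel_interior (lh_cone s) = interior (lh_cone s)"
    using sub by (intro rel_interior_nonempty_interior) auto
  \<comment> \<open>An interior point stays in the cone after subtracting a small multiple
    \<open>\<epsilon>\<close> of \<open>vertex_sum s\<close>. This lowers each facet value by
    \<open>\<epsilon>\<close>, so each was at least \<open>\<epsilon>\<close>.\<close>
  moreover have "interior (lh_cone s) \<subseteq> lh_cone_interior s"
  proof
    fix p assume p: "p \<in> interior (lh_cone s)"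
    have "((\<lambda>\<epsilon>. p - \<epsilon> *\<^sub>R ?v) \<longlongrightarrow> p - 0 *\<^sub>R ?v) (at_right 0)"
      by (intro tendsto_intros)
    then have "\<forall>\<^sub>F \<epsilon> in at_right 0. p - \<epsilon> *\<^sub>R ?v \<in> interior (lh_cone s)"
      using p by (intro topological_tendstoD[where l = p]) auto
    then have "\<forall>\<^sub>F \<epsilon> in at_right 0. \<epsilon> > 0 \<and> p - \<epsilon> *\<^sub>R ?v \<in> interior (lh_cone s)"
      by (intro eventually_conj eventually_at_right_less)
    then obtain \<epsilon> where e: "\<epsilon> > 0" "p - \<epsilon> *\<^sub>R ?v \<in> interior (lh_cone s)"
      using eventually_happens' trivial_limit_at_right_real by blast
    then have "p - \<epsilon> *\<^sub>R ?v \<in> lh_cone s" using interior_subset by blast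
    then have "\<forall>i\<le>CARD('n). 0 \<le> facet s p i - \<epsilon>"
      using facet_vertex_sum[OF assms] by (simp add: lh_cone_def facet_diff facet_scaleR)
    then show "p \<in> lh_cone_interior s"
      using e(1) by (fastforce simp: lh_cone_interior_def)
  qed
  ultimately show ?thesis using sub by auto
qed

subsection \<open>Lattice points and inversion sequences\<close>

abbreviation lattice_facet :: "nat ^ 'n::{finite,linorder} \<Rightarrow> (int ^ 'n::{finite,linorder}) \<times> int \<Rightarrow> nat \<Rightarrow> real" where
  "lattice_facet s p i \<equiv> facet s (of_lattice p) i"

definition cone_points :: "nat ^ 'n::{finite,linorder} \<Rightarrow> ((int ^ 'n::{finite,linorder}) \<times> int) set" where
  "cone_points s = {p. \<forall>i\<le>CARD('n). 0 \<le> lattice_facet s p i}"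

definition interior_points :: "nat ^ 'n::{finite,linorder} \<Rightarrow> ((int ^ 'n::{finite,linorder}) \<times> int) set" where
  "interior_points s = {p. \<forall>i\<le>CARD('n). 0 < lattice_facet s p i}"

text \<open>Congruence modulo the sublattice spanned by the points \<open>(v, 1)\<close>, \<open>v\<close> a vertex.\<close>

definition vertex_congruent ::
    "nat ^ 'n \<Rightarrow> (int ^ 'n) \<times> int \<Rightarrow> (int ^ 'n) \<times> int \<Rightarrow> bool" where
  "vertex_congruent s p q \<longleftrightarrow> (\<forall>j. int (s $ j) dvd fst p $ j - fst q $ j)"

text \<open>
  The lattice point of the half-open parallelepiped of the cone in the class of \<open>-e\<close>. With the
  sign reversed, its height is the number of ascents rather than of descents.
\<close>

definition box_point :: "nat ^ 'n::{finite,linorder} \<Rightarrow> nat ^ 'n::{finite,linorder} \<Rightarrow> (int ^ 'n::{finite,linorder}) \<times> int" where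
  "box_point s e =
     (vec_of_coords (\<lambda>i. int (card {j \<in> Asc s e. j < i} * coord s i) - int (coord e i)),
      int (asc s e))"

lemma snd_box_point [simp]: "snd (box_point s e) = int (asc s e)"
  by (simp add: box_point_def)

lemma snd_vertex_sum [simp]:
  "snd (vertex_sum s) = int CARD('n) + 1" for s :: "nat ^ 'n::{finite,linorder}"
  by (simp add: vertex_sum_def)

lemma snd_eq_sum_lattice_facet:
  "real_of_int (snd p) = (\<Sum>i\<le>CARD('n). lattice_facet s p i)" for s :: "nat ^ 'n::{finite,linorder}"
  using snd_eq_sum_facet[of "of_lattice p" s] by (simp add: of_lattice_def)

lemma vertex_congruent_vertex_sum: "vertex_congruent s (vertex_sum s) 0"
  unfolding vertex_congruent_def all_index_iff
  by (auto simp: vertex_sum_def coord_def[symmetric]) (simp add: coord_def)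

lemma vertex_congruent_box_point:
  "int (s $ j) dvd fst (box_point s e) $ j + int (e $ j)" for j :: "'n::{finite,linorder}"
proof -
  have "\<forall>j. int (s $ j) dvd fst (box_point s e) $ j + int (e $ j)"
    unfolding all_index_iff by (auto simp: box_point_def coord_def[symmetric])
  then show ?thesis by blast
qed

lemma cone_ratio_of_lattice_Ints:
  fixes s :: "nat ^ 'n::{finite,linorder}"
  assumes "vertex_congruent s p 0"
  shows "cone_ratio s (of_lattice p) i \<in> \<int>"
proof -
  have "int (coord s i) dvd coord (fst p) i"
    using assms by (simp add: vertex_congruent_def coord_def)
  then obtain k where "coord (fst p) i = int (coord s i) * k" by blast
  \<comment> \<open>Division by 0 yields 0, so the ratio is an integer also when
    \<open>coord s i = 0\<close>.\<close>
  then have "coord (fst (of_lattice p)) i / real (coord s i) = (if coord s i = 0 then 0 else of_int k)"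
    by (simp add: of_lattice_def coord_def)
  then show ?thesis by (simp add: cone_ratio_def of_lattice_def)
qed

text \<open>Facet values are integers on the class of 0, so a strict lower bound of -1 already gives
  nonnegativity.\<close>

lemma cone_pointsI_congruent:
  fixes s :: "nat ^ 'n::{finite,linorder}"
  assumes "vertex_congruent s p 0" "\<And>i. i \<le> CARD('n) \<Longrightarrow> - 1 < lattice_facet s p i"
  shows "p \<in> cone_points s"
proof -
  have "0 \<le> lattice_facet s p i" if "i \<le> CARD('n)" for i
  proof -
    have "lattice_facet s p i \<in> \<int>"
      unfolding facet_def by (intro Ints_diff cone_ratio_of_lattice_Ints assms(1))
    then obtain k where k: "lattice_facet s p i = of_int k" by (elim Ints_cases)
    with assms(2)[OF that] have "- 1 < k" by simp
    with k show ?thesis by simp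
  qed
  then show ?thesis by (simp add: cone_points_def)
qed

lemma cone_points_add: "p \<in> cone_points s \<Longrightarrow> q \<in> cone_points s \<Longrightarrow> p + q \<in> cone_points s"
  by (simp add: cone_points_def of_lattice_add facet_add)

lemma zero_in_cone_points: "0 \<in> cone_points s"
  by (simp add: cone_points_def facet_def cone_ratio_def of_lattice_def coord_def)

lemma snd_cone_points: "p \<in> cone_points s \<Longrightarrow> 0 \<le> snd p"
  using sum_nonneg[of "{..CARD('a)}" "lattice_facet s p"] snd_eq_sum_lattice_facet[of p s]
  by (auto simp: cone_points_def)

lemma of_lattice_eq_0_iff: "of_lattice p = 0 \<longleftrightarrow> p = 0"
  by (auto simp: of_lattice_def prod_eq_iff vec_eq_iff)

lemma inv_ratio_bounds:
  assumes "e \<in> inversion_sequences s"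
  shows "0 \<le> inv_ratio s e i" "inv_ratio s e i < 1"
proof -
  have "coord e i < coord s i"
    using assms by (simp add: inversion_sequences_def coord_def)
  then show "0 \<le> inv_ratio s e i" "inv_ratio s e i < 1"
    by (auto simp: inv_ratio_def)
qed

context
  fixes s :: "nat ^ 'n::{finite,linorder}"
  assumes pos: "\<forall>j. 1 \<le> s $ j"
begin

lemma finite_inversion_sequences: "finite (inversion_sequences s)"
proof -
  have "inversion_sequences s \<subseteq> (\<lambda>f. \<chi> j. f j) ` (PiE UNIV (\<lambda>j. {..<s $ j}))"
  proof
    fix e assume "e \<in> inversion_sequences s"
    then show "e \<in> (\<lambda>f. \<chi> j. f j) ` (PiE UNIV (\<lambda>j. {..<s $ j}))"
      by (intro image_eqI[of _ _ "($) e"]) (auto simp: inversion_sequences_def)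
  qed
  then show ?thesis
    by (rule finite_subset) (intro finite_imageI finite_PiE, auto)
qed

text \<open>The height is a sum of nonnegative facet values. This turns equalities of heights into
  equalities of points.\<close>

lemma eq_0_if_snd_le_0:
  assumes "p \<in> cone_points s" "snd p \<le> 0"
  shows "p = 0"
proof -
  have f: "0 \<le> lattice_facet s p i" if "i \<le> CARD('n)" for i
    using assms(1) that by (simp add: cone_points_def)
  have "(\<Sum>i\<le>CARD('n). lattice_facet s p i) = 0"
    using snd_eq_sum_lattice_facet[of p s] assms snd_cone_points[OF assms(1)] by simp
  then have "\<forall>i\<in>{..CARD('n)}. lattice_facet s p i = 0"
    by (subst (asm) sum_nonneg_eq_0_iff) (auto intro: f)
  then have "of_lattice p = 0" by (intro eq_0_if_facet_eq_0[OF pos]) auto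
  then show ?thesis by (simp add: of_lattice_eq_0_iff)
qed

lemma cone_points_antisym:
  assumes "p - q \<in> cone_points s" "q - p \<in> cone_points s"
  shows "p = q"
proof -
  have "snd (p - q) \<le> 0" using snd_cone_points[OF assms(2)] by simp
  then show ?thesis using eq_0_if_snd_le_0[OF assms(1)] by simp
qed

section \<open>Box points as representatives of lattice classes\<close>

lemma cone_ratio_box_point:
  assumes "i \<le> CARD('n)"
  shows "cone_ratio s (of_lattice (box_point s e)) i = real (card {j \<in> Asc s e. j < i}) - inv_ratio s e i"
proof (cases "i = 0")
  case False
  then have i: "i \<in> {1..CARD('n)}" using assms by auto
  have "coord (fst (of_lattice (box_point s e))) i
      = real (card {j \<in> Asc s e. j < i}) * real (coord s i) - real (coord e i)"
    using coord_vec_of_coords[OF i, of "\<lambda>i. int (card {j \<in> Asc s e. j < i} * coord s i) - int (coord e i)"]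
    by (simp add: of_lattice_def box_point_def coord_def)
  then show ?thesis
    using i coord_pos[OF pos, of i] by (simp add: cone_ratio_def inv_ratio_def field_simps)
qed (simp add: cone_ratio_def inv_ratio_def)

text \<open>Below n, the facet value is 1 at an ascent and 0 elsewhere, minus the increase of the
  ratio of \<open>e\<close>. This increase is positive exactly at ascents and has absolute value
  below 1.\<close>

lemma facet_box_point:
  assumes "e \<in> inversion_sequences s" "i \<le> CARD('n)"
  shows "0 \<le> lattice_facet s (box_point s e) i" "lattice_facet s (box_point s e) i < 1"
proof -
  have *: "0 \<le> lattice_facet s (box_point s e) i \<and> lattice_facet s (box_point s e) i < 1"
  proof (cases "i = CARD('n)")
    case True
    \<comment> \<open>At the last facet the height \<open>asc s e\<close> cancels the count of all
      ascents and leaves the last ratio of \<open>e\<close>.\<close>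
    have "{j \<in> Asc s e. j < i} = Asc s e" using True by (auto simp: Asc_def)
    then have "lattice_facet s (box_point s e) i = inv_ratio s e i"
      using cone_ratio_box_point[of i e] True
      by (simp add: facet_def) (simp add: cone_ratio_def of_lattice_def asc_def)
    then show ?thesis using inv_ratio_bounds[OF assms(1)] by simp
  next
    case False
    then have i: "i < CARD('n)" using assms(2) by simp
    have "finite (Asc s e)" by (simp add: Asc_def)
    moreover have "{j \<in> Asc s e. j < Suc i} =
        (if i \<in> Asc s e then insert i {j \<in> Asc s e. j < i} else {j \<in> Asc s e. j < i})"
      by (auto simp: less_Suc_eq)
    ultimately have "real (card {j \<in> Asc s e. j < Suc i}) =
        card {j \<in> Asc s e. j < i} + (if i \<in> Asc s e then 1 else 0)"
      by simp
    then have "lattice_facet s (box_point s e) i =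
        (if i \<in> Asc s e then 1 else 0) - (inv_ratio s e (Suc i) - inv_ratio s e i)"
      using i by (simp add: facet_def cone_ratio_box_point)
    moreover have "i \<in> Asc s e \<longleftrightarrow> inv_ratio s e i < inv_ratio s e (Suc i)"
      using i by (simp add: Asc_def)
    ultimately show ?thesis
      using inv_ratio_bounds[OF assms(1), of i] inv_ratio_bounds[OF assms(1), of "Suc i"] by auto
  qed
  then show "0 \<le> lattice_facet s (box_point s e) i" "lattice_facet s (box_point s e) i < 1"
    by auto
qed

lemma box_point_in_cone_points: "e \<in> inversion_sequences s \<Longrightarrow> box_point s e \<in> cone_points s"
  by (simp add: cone_points_def facet_box_point)

text \<open>Facet values in [0, 1) become values in (0, 1].\<close>

lemma vertex_sum_minus_box_point_interior:
  "e \<in> inversion_sequences s \<Longrightarrow> vertex_sum s - box_point s e \<in> interior_points s"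
  by (simp add: interior_points_def of_lattice_diff facet_diff facet_vertex_sum[OF pos] facet_box_point)

lemma ex_congruent_box_point:
  "\<exists>e\<in>inversion_sequences s. vertex_congruent s p (box_point s e)"
proof -
  \<comment> \<open>\<open>box_point s e\<close> lies in the class of \<open>-e\<close>, so
    \<open>e\<close> has to be the residue of minus the coordinates of \<open>p\<close>.\<close>
  define e where "e = (\<chi> j. nat ((- (fst p $ j)) mod int (s $ j)))"
  have sp: "int (s $ j) > 0" for j
    using pos by (metis of_nat_0_less_iff less_le_trans zero_less_one)
  have e: "int (e $ j) = (- (fst p $ j)) mod int (s $ j)" for j
    using sp[of j] by (simp add: e_def)
  have "int (e $ j) < int (s $ j)" for j
    unfolding e using sp by (rule pos_mod_bound)
  then have "e \<in> inversion_sequences s" by (simp add: inversion_sequences_def)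
  moreover have "int (s $ j) dvd fst p $ j - fst (box_point s e) $ j" for j
  proof -
    have "int (s $ j) dvd fst p $ j + int (e $ j)"
      unfolding e by (metis mod_add_right_eq add.right_inverse mod_0 dvd_eq_mod_eq_0)
    then have "int (s $ j) dvd (fst p $ j + int (e $ j)) - (fst (box_point s e) $ j + int (e $ j))"
      using vertex_congruent_box_point by (rule dvd_diff)
    then show ?thesis by simp
  qed
  ultimately show ?thesis by (auto simp: vertex_congruent_def)
qed

text \<open>With \<open>box_point s e\<close> in the class of \<open>-p\<close>, the point in
  question is congruent to 0 and has facet values above 0 - 1 + 0, so
  \<open>cone_pointsI_congruent\<close> applies.\<close>

lemma ex_box_point_above_interior:
  assumes "p \<in> interior_points s"
  shows "\<exists>e\<in>inversion_sequences s. p - vertex_sum s + box_point s e \<in> cone_points s"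
proof -
  let ?V = "vertex_sum s"
  obtain e where e: "e \<in> inversion_sequences s" "vertex_congruent s (- p) (box_point s e)"
    using ex_congruent_box_point by blast
  let ?x = "p - ?V + box_point s e"
  have "?x \<in> cone_points s"
  proof (rule cone_pointsI_congruent)
    show "vertex_congruent s ?x 0"
      unfolding vertex_congruent_def
    proof
      fix j
      have "int (s $ j) dvd - (fst (- p) $ j - fst (box_point s e) $ j)"
        using e(2) unfolding vertex_congruent_def dvd_minus_iff by blast
      moreover have "int (s $ j) dvd fst ?V $ j"
        using vertex_congruent_vertex_sum[of s] by (simp add: vertex_congruent_def)
      ultimately have "int (s $ j) dvd
          - (fst (- p) $ j - fst (box_point s e) $ j) - fst ?V $ j"
        by (rule dvd_diff)
      moreover have "- (fst (- p) $ j - fst (box_point s e) $ j) - fst ?V $ j = fst ?x $ j"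
        by simp
      ultimately show "int (s $ j) dvd fst ?x $ j - fst (0 :: (int ^ 'n::{finite,linorder}) \<times> int) $ j"
        by (simp only: fst_zero zero_index diff_zero)
    qed
    fix i assume i: "i \<le> CARD('n)"
    then have "0 < lattice_facet s p i" using assms by (simp add: interior_points_def)
    then show "- 1 < lattice_facet s ?x i"
      using facet_box_point(1)[OF e(1) i] facet_vertex_sum[OF pos i]
      by (simp add: of_lattice_diff of_lattice_add facet_diff facet_add)
  qed
  then show ?thesis using e(1) by blast
qed

text \<open>Facet values of congruent points differ by integers, and two values in [0, 1) differ by
  less than 1. So each class has only one representative in the half-open parallelepiped.\<close>

lemma box_point_eqI:
  assumes "e \<in> inversion_sequences s" "vertex_congruent s p (box_point s e)"
    and "\<And>i. i \<le> CARD('n) \<Longrightarrow> 0 \<le> lattice_facet s p i" "\<And>i. i \<le> CARD('n) \<Longrightarrow> lattice_facet s p i < 1"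
  shows "p = box_point s e"
proof (rule cone_points_antisym)
  have c: "vertex_congruent s (p - box_point s e) 0" "vertex_congruent s (box_point s e - p) 0"
    using assms(2) by (auto simp: vertex_congruent_def dvd_diff_commute)
  have b: "\<bar>lattice_facet s p i - lattice_facet s (box_point s e) i\<bar> < 1" if "i \<le> CARD('n)" for i
    using assms(3,4)[OF that] facet_box_point[OF assms(1) that] by simp
  show "p - box_point s e \<in> cone_points s"
    by (rule cone_pointsI_congruent[OF c(1)]) (use b in \<open>force simp: of_lattice_diff facet_diff\<close>)
  show "box_point s e - p \<in> cone_points s"
    by (rule cone_pointsI_congruent[OF c(2)]) (use b in \<open>force simp: of_lattice_diff facet_diff\<close>)
qed

lemma inv_add_in_inversion_sequences: "inv_add s e e' \<in> inversion_sequences s"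
proof -
  have "0 < s $ j" for j using pos by (metis less_le_trans zero_less_one)
  then show ?thesis by (simp add: inversion_sequences_def inv_add_def)
qed

text \<open>Modulo \<open>s\<close> each box point is minus its inversion sequence, so
  \<open>inv_add\<close> is the addition of classes.\<close>

lemma vertex_congruent_box_point_inv_add:
  "vertex_congruent s (box_point s e + box_point s e') (box_point s (inv_add s e e'))"
  unfolding vertex_congruent_def
proof
  fix j
  let ?b = "\<lambda>e. fst (box_point s e) $ j"
  let ?f = "inv_add s e e'"
  have "int (s $ j) dvd int (e $ j + e' $ j) - int ((e $ j + e' $ j) mod s $ j)"
    by (metis dvd_minus_mod of_nat_dvd_iff of_nat_diff mod_less_eq_dividend)
  then have "int (s $ j) dvd int (e $ j) + int (e' $ j) - int (?f $ j)"
    by (simp add: inv_add_def)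
  moreover have "int (s $ j) dvd (?b e + int (e $ j)) + (?b e' + int (e' $ j)) - (?b ?f + int (?f $ j))"
    by (intro dvd_add dvd_diff vertex_congruent_box_point)
  ultimately have "int (s $ j) dvd (?b e + int (e $ j)) + (?b e' + int (e' $ j)) - (?b ?f + int (?f $ j))
      - (int (e $ j) + int (e' $ j) - int (?f $ j))"
    by (rule dvd_diff[rotated])
  then show "int (s $ j) dvd fst (box_point s e + box_point s e') $ j - ?b ?f"
    by (simp add: algebra_simps)
qed

text \<open>The sum of the box points minus the box point of the sum is congruent to 0 with facet
  values above -1, hence in the cone. Additivity of \<open>asc\<close> makes its height 0.\<close>

lemma box_point_inv_add_if_asc:
  assumes "e \<in> inversion_sequences s" "e' \<in> inversion_sequences s"
    and "asc s (inv_add s e e') = asc s e + asc s e'"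
  shows "box_point s (inv_add s e e') = box_point s e + box_point s e'"
proof -
  let ?p = "box_point s e + box_point s e' - box_point s (inv_add s e e')"
  have "?p \<in> cone_points s"
  proof (rule cone_pointsI_congruent)
    show "vertex_congruent s ?p 0"
      using vertex_congruent_box_point_inv_add[of e e'] by (simp add: vertex_congruent_def)
    fix i assume i: "i \<le> CARD('n)"
    show "- 1 < lattice_facet s ?p i"
      using facet_box_point(1)[OF assms(1) i] facet_box_point(1)[OF assms(2) i]
        facet_box_point(2)[OF inv_add_in_inversion_sequences i, of e e']
      by (simp add: of_lattice_diff of_lattice_add facet_diff facet_add)
  qed
  moreover have "snd ?p \<le> 0" using assms(3) by simp
  ultimately have "?p = 0" by (rule eq_0_if_snd_le_0)
  then show ?thesis by simp
qed

section \<open>The order on box points and the level condition\<close>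

lemma extend_to_max_asc:
  fixes r :: nat
  assumes r: "\<And>e. e \<in> inversion_sequences s \<Longrightarrow> asc s e \<le> r" "\<exists>e\<in>inversion_sequences s. asc s e = r"
    and cond: "\<And>k e. 1 \<le> k \<Longrightarrow> k < r \<Longrightarrow> e \<in> inversion_sequences_asc s k \<Longrightarrow>
        \<exists>e'\<in>inversion_sequences_asc s 1. inv_add s e e' \<in> inversion_sequences_asc s (k + 1)"
    and e: "e \<in> inversion_sequences s"
  shows "\<exists>f\<in>inversion_sequences s. asc s f = r \<and> box_point s f - box_point s e \<in> cone_points s"
  using e
proof (induction "r - asc s e" arbitrary: e)
  case 0
  then have "asc s e = r" using r(1)[of e] by simp
  then show ?case using 0 zero_in_cone_points[of s] by (intro bexI[of _ e]) auto
next
  case (Suc m)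
  show ?case
  \<comment> \<open>The condition only starts at \<open>k = 1\<close>. Without ascents the box point
    is 0 and lies below every box point, so any maximal \<open>f\<close> serves.\<close>
  proof (cases "asc s e = 0")
    case True
    then have "box_point s e = 0"
      using box_point_in_cone_points[OF Suc.prems] by (intro eq_0_if_snd_le_0) auto
    then show ?thesis using r(2) box_point_in_cone_points by auto
  next
    case False
    then obtain e' where e': "e' \<in> inversion_sequences s" "asc s e' = 1"
      "asc s (inv_add s e e') = asc s e + 1"
      using cond[of "asc s e" e] Suc.hyps(2) Suc.prems
      unfolding inversion_sequences_asc_def by fastforce
    let ?g = "inv_add s e e'"
    have "m = r - asc s ?g" using Suc.hyps(2) e'(3) by simp
    then obtain f where f: "f \<in> inversion_sequences s" "asc s f = r"
        "box_point s f - box_point s ?g \<in> cone_points s"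
      using Suc.hyps(1) inv_add_in_inversion_sequences by blast
    have "box_point s f - box_point s e = (box_point s f - box_point s ?g) + box_point s e'"
      using box_point_inv_add_if_asc[of e e'] Suc.prems e' by simp
    also have "\<dots> \<in> cone_points s"
      using f(3) box_point_in_cone_points[OF e'(1)] by (rule cone_points_add)
    finally show ?thesis using f by blast
  qed
qed

text \<open>This is the integer decomposition property: cut all ratios off at \<open>1\<close>.\<close>

lemma ex_height_one_summand:
  assumes z: "z \<in> cone_points s" "1 \<le> snd z"
  shows "\<exists>y\<in>cone_points s. snd y = 1 \<and> z - y \<in> cone_points s"
proof -
  define y :: "(int ^ 'n::{finite,linorder}) \<times> int" where "y = ((\<chi> j. min (fst z $ j) (int (s $ j))), 1)"
  let ?R = "\<lambda>p. cone_ratio s (of_lattice p)"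
  have zf: "0 \<le> ?R z (Suc i) - ?R z i" if "i \<le> CARD('n)" for i
    using z(1) that by (auto simp: cone_points_def facet_def)
  have R: "?R y i = min (?R z i) 1" if "i \<le> Suc CARD('n)" for i
  proof -
    have "real_of_int (min a (int b)) / real b = min (real_of_int a / real b) 1" if "b > 0" for a b
      using that by (auto simp: min_def field_simps)
    then show ?thesis
      using coord_pos[OF pos, of i] z(2)
      by (auto simp: cone_ratio_def of_lattice_def y_def coord_def)
  qed
  \<comment> \<open>The ratios of \<open>z\<close> are nondecreasing. Capping at 1 and taking the
    excess over 1 are both monotone, so the ratios of \<open>y\<close> and of \<open>z - y\<close>
    are nondecreasing too.\<close>
  have *: "0 \<le> lattice_facet s y i" "0 \<le> lattice_facet s (z - y) i" if "i \<le> CARD('n)" for i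
    using R[of i] R[of "Suc i"] zf[OF that] that
    by (auto simp: of_lattice_diff facet_diff) (auto simp: facet_def min_def)
  then have "y \<in> cone_points s" "z - y \<in> cone_points s"
    by (auto simp: cone_points_def)
  moreover have "snd y = 1" by (simp add: y_def)
  ultimately show ?thesis by blast
qed

text \<open>The combinatorial core: generation in degree \<open>d\<close> is read as every interior
  point lying above one of height \<open>d\<close>.\<close>

theorem level_points_iff:
  fixes r :: nat
  assumes r: "r = Max (asc s ` inversion_sequences s)"
  shows "(\<exists>d. \<forall>p\<in>interior_points s. \<exists>w\<in>interior_points s. snd w = d \<and> p - w \<in> cone_points s) \<longleftrightarrow>
    (\<forall>k. 1 \<le> k \<and> k < r \<longrightarrow>
      (\<forall>e\<in>inversion_sequences_asc s k.
        \<exists>e'\<in>inversion_sequences_asc s 1.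
          inv_add s e e' \<in> inversion_sequences_asc s (k + 1)))" (is "?L \<longleftrightarrow> ?R")
proof -
  let ?V = "vertex_sum s" and ?b = "box_point s" and ?I = "inversion_sequences s"
  have r_le: "asc s e \<le> r" if "e \<in> ?I" for e
    unfolding r using finite_inversion_sequences that by (intro Max_ge) auto
  have "r \<in> asc s ` ?I"
    \<comment> \<open>Any value of \<open>inv_add\<close> witnesses that there is an inversion
      sequence, so the maximum is attained.\<close>
    unfolding r using finite_inversion_sequences inv_add_in_inversion_sequences by (intro Max_in) auto
  then have r_ex: "\<exists>e\<in>?I. asc s e = r" by auto
  note fV = facet_vertex_sum[OF pos]
  show ?thesis
  proof
    assume R: ?R
    show ?L
    proof (intro exI ballI)
      fix p assume p: "p \<in> interior_points s"
      obtain e where e: "e \<in> ?I" "p - ?V + ?b e \<in> cone_points s"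
        using ex_box_point_above_interior[OF p] by blast
      obtain f where f: "f \<in> ?I" "asc s f = r" "?b f - ?b e \<in> cone_points s"
        using extend_to_max_asc[OF r_le r_ex _ e(1)] R by blast
      from cone_points_add[OF e(2) f(3)] have "p - (?V - ?b f) \<in> cone_points s"
        by (simp add: algebra_simps)
      then show "\<exists>w\<in>interior_points s. snd w = int CARD('n) + 1 - int r \<and> p - w \<in> cone_points s"
        using vertex_sum_minus_box_point_interior[OF f(1)] f(2) by (intro bexI[of _ "?V - ?b f"]) auto
    qed
  next
    assume ?L
    then obtain d where d: "\<And>p. p \<in> interior_points s \<Longrightarrow>
        \<exists>w\<in>interior_points s. snd w = d \<and> p - w \<in> cone_points s" by blast
    obtain f0 where f0: "f0 \<in> ?I" "asc s f0 = r" using r_ex by blast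
    \<comment> \<open>An interior point of height n + 1 - r bounds the common degree
      \<open>d\<close> from above.\<close>
    obtain w0 where "snd w0 = d" "?V - ?b f0 - w0 \<in> cone_points s"
      using d[OF vertex_sum_minus_box_point_interior[OF f0(1)]] by blast
    then have d_le: "d \<le> int CARD('n) + 1 - int r"
      using snd_cone_points[of "?V - ?b f0 - w0" s] f0(2) by simp
    show ?R
    proof (intro allI impI ballI)
      fix k e assume k: "1 \<le> k \<and> k < r" and "e \<in> inversion_sequences_asc s k"
      then have e: "e \<in> ?I" "asc s e = k" by (auto simp: inversion_sequences_asc_def)
      obtain w where w: "w \<in> interior_points s" "snd w = d" "?V - ?b e - w \<in> cone_points s"
        using d[OF vertex_sum_minus_box_point_interior[OF e(1)]] by blast
      obtain f where f: "f \<in> ?I" "w - ?V + ?b f \<in> cone_points s"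
        using ex_box_point_above_interior[OF w(1)] by blast
      let ?x = "w - ?V + ?b f"
      \<comment> \<open>The point \<open>w\<close> of height \<open>d\<close> lies above V - b(f),
        whose height n + 1 - asc(f) is at least n + 1 - r and so at least \<open>d\<close>. Hence
        the two coincide and asc(f) = r.\<close>
      have "snd ?x \<le> 0"
        using d_le w(2) r_le[OF f(1)] by simp
      with f(2) have x0: "?x = 0" by (rule eq_0_if_snd_le_0)
      have "?V - ?b e - w = (?b f - ?b e) - ?x" by simp
      also have "\<dots> = ?b f - ?b e" by (simp only: x0 diff_zero)
      finally have z: "?b f - ?b e \<in> cone_points s" using w(3) by (simp only:)
      have "snd ?x = 0" by (simp only: x0 snd_zero)
      then have "asc s f = r" using d_le w(2) r_le[OF f(1)] by simp
      then have "1 \<le> snd (?b f - ?b e)" using k e(2) by simp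
      then obtain y where y: "y \<in> cone_points s" "snd y = 1" "?b f - ?b e - y \<in> cone_points s"
        using ex_height_one_summand[OF z] by blast
      \<comment> \<open>As b(e) + y lies below b(f), its facet values are below 1. By uniqueness of
        representatives, both y and b(e) + y are then box points.\<close>
      have y0: "0 \<le> lattice_facet s y i"
        and y1: "lattice_facet s (?b e) i + lattice_facet s y i < 1" if i: "i \<le> CARD('n)" for i
      proof -
        show "0 \<le> lattice_facet s y i" using y(1) i by (simp add: cone_points_def)
        have "0 \<le> lattice_facet s (?b f - ?b e - y) i"
          using y(3) i unfolding cone_points_def by blast
        then show "lattice_facet s (?b e) i + lattice_facet s y i < 1"
          using facet_box_point(2)[OF f(1) i] by (simp add: of_lattice_diff facet_diff)
      qed
      obtain e' where e': "e' \<in> ?I" "vertex_congruent s y (?b e')"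
        using ex_congruent_box_point by blast
      have y_eq: "y = ?b e'"
      proof (rule box_point_eqI[OF e'])
        fix i assume i: "i \<le> CARD('n)"
        show "0 \<le> lattice_facet s y i" using y0[OF i] .
        show "lattice_facet s y i < 1" using y1[OF i] facet_box_point(1)[OF e(1) i] by simp
      qed
      moreover have "?b e + ?b e' = ?b (inv_add s e e')"
      proof (rule box_point_eqI[OF inv_add_in_inversion_sequences vertex_congruent_box_point_inv_add])
        fix i assume i: "i \<le> CARD('n)"
        show "0 \<le> lattice_facet s (?b e + ?b e') i"
          by (simp add: of_lattice_add facet_add facet_box_point i e(1) e'(1))
        show "lattice_facet s (?b e + ?b e') i < 1"
          using y1[OF i] by (simp add: y_eq[symmetric] of_lattice_add facet_add)
      qed
      ultimately have "int (asc s e') = 1" "int (asc s (inv_add s e e')) = int k + 1"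
        using y(2) e(2) snd_add[of "?b e" "?b e'"] by simp_all
      then have "asc s e' = 1" "asc s (inv_add s e e') = k + 1" by linarith+
      then show "\<exists>e'\<in>inversion_sequences_asc s 1. inv_add s e e' \<in> inversion_sequences_asc s (k + 1)"
        using e'(1) inv_add_in_inversion_sequences
        by (intro bexI[of _ e']) (auto simp: inversion_sequences_asc_def)
    qed
  qed
qed

end

subsection \<open>Homogeneous generators of monomial modules\<close>

lemma sum_single_lookup: "(\<Sum>k\<in>Poly_Mapping.keys f. Poly_Mapping.single k (Poly_Mapping.lookup f k)) = f"
  by (rule poly_mapping_eqI) (simp add: lookup_sum lookup_single when_def in_keys_iff)

lemma one_in_monomial_span: "0 \<in> S \<Longrightarrow> (1 :: 'm::monoid_add \<Rightarrow>\<^sub>0 'k::{zero_neq_one}) \<in> monomial_span S"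
  by (simp add: monomial_span_def)

lemma monomial_span_sum:
  assumes "\<And>i. i \<in> I \<Longrightarrow> f i \<in> monomial_span S"
  shows "sum f I \<in> monomial_span S"
  using assms by (induction I rule: infinite_finite_induct)
    (use keys_add in \<open>fastforce simp: monomial_span_def\<close>)+

lemma monomial_span_mult:
  assumes "f \<in> monomial_span S" "g \<in> monomial_span T" "\<And>a b. a \<in> S \<Longrightarrow> b \<in> T \<Longrightarrow> a + b \<in> T"
  shows "f * g \<in> monomial_span T"
  using assms keys_mult[of f g] unfolding monomial_span_def by fast

text \<open>Exponents of a product are sums of exponents of the factors, so each monomial of the
  module has an exponent of degree \<open>d\<close> below its own. Conversely, the monomials with
  such exponents generate.\<close>

lemma homogeneous_generators_iff:
  fixes S T :: "((int ^ 'n) \<times> int) set"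
  assumes S0: "0 \<in> S" and ST: "\<And>a b. a \<in> S \<Longrightarrow> b \<in> T \<Longrightarrow> a + b \<in> T"
  shows "(\<exists>G :: (((int ^ 'n) \<times> int) \<Rightarrow>\<^sub>0 'k::field) set.
      (\<forall>g\<in>G. homogeneous_of_degree d g) \<and>
      submodule_generated (monomial_span S) G = monomial_span T) \<longleftrightarrow>
    (\<forall>p\<in>T. \<exists>w\<in>T. snd w = d \<and> p - w \<in> S)" (is "(\<exists>G. ?P G) \<longleftrightarrow> ?R")
proof
  assume "\<exists>G. ?P G"
  then obtain G :: "(((int ^ 'n) \<times> int) \<Rightarrow>\<^sub>0 'k) set" where
    hom: "\<And>g. g \<in> G \<Longrightarrow> homogeneous_of_degree d g" and
    gen: "submodule_generated (monomial_span S) G = monomial_span T" by blast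
  have G_sub: "G \<subseteq> monomial_span T"
  proof
    fix g assume "g \<in> G"
    then have "g \<in> submodule_generated (monomial_span S) G"
      using one_in_monomial_span[OF S0] unfolding submodule_generated_def
      by (intro CollectI exI[of _ "{g}"] exI[of _ "\<lambda>_. 1"]) simp
    then show "g \<in> monomial_span T" by (simp add: gen)
  qed
  show ?R
  proof
    fix p assume "p \<in> T"
    then have "Poly_Mapping.single p (1 :: 'k) \<in> submodule_generated (monomial_span S) G"
      unfolding gen by (simp add: monomial_span_def)
    then obtain F a where F: "F \<subseteq> G" "\<forall>g\<in>F. a g \<in> monomial_span S"
        and eq: "Poly_Mapping.single p (1 :: 'k) = (\<Sum>g\<in>F. a g * g)"
      unfolding submodule_generated_def by blast
    have "p \<in> Poly_Mapping.keys (\<Sum>g\<in>F. a g * g)"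
      unfolding eq[symmetric] by simp
    then obtain g where g: "g \<in> F" "p \<in> Poly_Mapping.keys (a g * g)"
      using keys_sum[of "\<lambda>g. a g * g" F] by blast
    then obtain z w where zw: "p = z + w" "z \<in> Poly_Mapping.keys (a g)" "w \<in> Poly_Mapping.keys g"
      using keys_mult[of "a g" g] by blast
    have "w \<in> T" using zw(3) g(1) F(1) G_sub by (auto simp: monomial_span_def)
    moreover have "snd w = d"
      using hom[of g] zw(3) g(1) F(1) by (auto simp: homogeneous_of_degree_def)
    moreover have "p - w \<in> S" using zw(1,2) F(2) g(1) by (auto simp: monomial_span_def)
    ultimately show "\<exists>w\<in>T. snd w = d \<and> p - w \<in> S" by blast
  qed
next
  assume ?R
  then have "\<forall>p. \<exists>w. p \<in> T \<longrightarrow> w \<in> T \<and> snd w = d \<and> p - w \<in> S" by blast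
  from choice[OF this] obtain w
    where w: "\<And>p. p \<in> T \<Longrightarrow> w p \<in> T \<and> snd (w p) = d \<and> p - w p \<in> S" by blast
  define G :: "(((int ^ 'n) \<times> int) \<Rightarrow>\<^sub>0 'k) set"
    where "G = (\<lambda>p. Poly_Mapping.single (w p) 1) ` T"
  have "\<forall>g\<in>G. homogeneous_of_degree d g"
    using w by (auto simp: G_def homogeneous_of_degree_def)
  moreover have "submodule_generated (monomial_span S) G = monomial_span T"
  proof
    have "a * g \<in> monomial_span T" if "g \<in> G" "a \<in> monomial_span S" for a g
      using that w by (intro monomial_span_mult[OF _ _ ST]) (auto simp: G_def monomial_span_def)
    then show "submodule_generated (monomial_span S) G \<subseteq> monomial_span T"
      by (auto simp: submodule_generated_def intro!: monomial_span_sum)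
    show "monomial_span T \<subseteq> submodule_generated (monomial_span S) G"
    proof
      fix f :: "((int ^ 'n) \<times> int) \<Rightarrow>\<^sub>0 'k"
      assume "f \<in> monomial_span T"
      then have f: "p \<in> T" if "p \<in> Poly_Mapping.keys f" for p
        using that by (auto simp: monomial_span_def)
      define X where "X p = Poly_Mapping.single (w p) (1 :: 'k)" for p
      \<comment> \<open>Several exponents \<open>p\<close> may share the generator
        \<open>X p\<close>; its coefficient collects all of them.\<close>
      define a where "a g = (\<Sum>p | p \<in> Poly_Mapping.keys f \<and> X p = g.
          Poly_Mapping.single (p - w p) (Poly_Mapping.lookup f p))" for g
      have "(\<Sum>g\<in>X ` Poly_Mapping.keys f. a g * g)
          = (\<Sum>g\<in>X ` Poly_Mapping.keys f. \<Sum>p | p \<in> Poly_Mapping.keys f \<and> X p = g.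
              Poly_Mapping.single (p - w p) (Poly_Mapping.lookup f p) * X p)"
        by (intro sum.cong refl) (simp add: a_def sum_distrib_right)
      also have "\<dots> = (\<Sum>p\<in>Poly_Mapping.keys f. Poly_Mapping.single (p - w p) (Poly_Mapping.lookup f p) * X p)"
        by (rule sum.image_gen[symmetric]) simp
      also have "\<dots> = (\<Sum>p\<in>Poly_Mapping.keys f. Poly_Mapping.single p (Poly_Mapping.lookup f p))"
        by (simp add: X_def mult_single)
      also have "\<dots> = f" by (rule sum_single_lookup)
      finally have "f = (\<Sum>g\<in>X ` Poly_Mapping.keys f. a g * g)" ..
      moreover have "a g \<in> monomial_span S" for g
        unfolding a_def
      proof (rule monomial_span_sum)
        fix p assume "p \<in> {p \<in> Poly_Mapping.keys f. X p = g}"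
        then show "Poly_Mapping.single (p - w p) (Poly_Mapping.lookup f p) \<in> monomial_span S"
          using w f by (simp add: monomial_span_def)
      qed
      moreover have "X ` Poly_Mapping.keys f \<subseteq> G"
        using f by (auto simp: G_def X_def)
      ultimately show "f \<in> submodule_generated (monomial_span S) G"
        unfolding submodule_generated_def
        by (intro CollectI exI[of _ "X ` Poly_Mapping.keys f"] exI[of _ a]) simp
    qed
  qed
  ultimately show "\<exists>G. ?P G" by blast
qed

section \<open>Levelness in terms of lattice points\<close>

lemma level_lecture_hall_iff:
  fixes s :: "nat ^ 'n::{finite,linorder}"
  assumes "\<forall>j. 1 \<le> s $ j"
  shows "level_polytope TYPE('k::{alg_closed_field, field_char_0}) (lecture_hall_polytope s) \<longleftrightarrow>
    (\<exists>d. \<forall>p\<in>interior_points s. \<exists>w\<in>interior_points s. snd w = d \<and> p - w \<in> cone_points s)"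
proof -
  have "lattice_points (lh_cone s) = cone_points s"
    by (auto simp: lattice_points_def lh_cone_def cone_points_def of_lattice_def)
  moreover have "lattice_points (lh_cone_interior s) = interior_points s"
    by (auto simp: lattice_points_def lh_cone_interior_def interior_points_def of_lattice_def)
  \<comment> \<open>Nonnegative plus positive facet values are positive, so the interior points span
    an ideal.\<close>
  moreover have "a + b \<in> interior_points s" if "a \<in> cone_points s" "b \<in> interior_points s" for a b
    using that by (simp add: cone_points_def interior_points_def of_lattice_add facet_add add_nonneg_pos)
  note homogeneous_generators_iff[OF zero_in_cone_points this, where 'k = 'k]
  ultimately show ?thesis
    unfolding level_polytope_def semigroup_algebra_def canonical_module_def
    by (simp add: polytope_cone_lecture_hall[OF assms] rel_interior_lh_cone[OF assms])
qed

theorem theorem4: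
  fixes s :: "nat ^ 'n::{finite,linorder}" and r :: nat
  assumes "\<forall>j. 1 \<le> s $ j"
    and "r = Max (asc s ` inversion_sequences s)"
  shows "level_polytope TYPE('k::{alg_closed_field, field_char_0}) (lecture_hall_polytope s) \<longleftrightarrow>
    (\<forall>k. 1 \<le> k \<and> k < r \<longrightarrow>
      (\<forall>e\<in>inversion_sequences_asc s k.
        \<exists>e'\<in>inversion_sequences_asc s 1.
          inv_add s e e' \<in> inversion_sequences_asc s (k + 1)))"
  unfolding level_lecture_hall_iff[OF assms(1)] by (rule level_points_iff[OF assms])

end
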